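(* Let $M\ge1$ and let $\tau_1,\dots,\tau_N$ be sporadic tasks with constrained deadlines ($D_i\le T_i$), indexed so that $D_1\le\cdots\le D_N$. Consider the deadline-monotonic partitioning algorithm with $M$ unit-speed processors, any fitting strategy, and the time-demand-analysis test: $\tau_k$ can be added to processor $m$ holding ${\bf T}_m$ iff there exists $t$ with $0<t\le D_k$ and $C_k+\sum_{\tau_i\in{\bf T}_m}\lceil t/T_i\rceil C_i\le t$. Suppose the algorithm has assigned $\tau_1,\dots,\tau_{k-1}$ and now considers $\tau_k$. Let ${\bf T}^{*1}=\{\tau_i: i<k,\ T_i<D_k\}$, ${\bf T}^{*2}=\{\tau_i:i<k,\ T_i\ge D_k\}$, and $C_k'=C_k+\frac1M\sum_{\tau_i\in{\bf T}^{*2}}C_i$. If $$\prod_{\tau_i\in{\bf T}^{*1}}\Big(1+\frac{U_i}{M}\Big)\le\frac{2}{1+\frac{C_k'}{D_k}},$$ then there is a processor $m$ passing the test for $\tau_k$, i.e., the algorithm succeeds in assigning $\tau_k$.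
   Context: A sporadic task $\tau_i=(C_i,T_i,D_i)$ has worst-case execution time $C_i>0$, minimum inter-arrival time $T_i>0$, relative deadline $D_i>0$; $U_i=C_i/T_i$. Deadline-monotonic partitioning algorithm: tasks indexed by non-decreasing relative deadline; ${\bf T}_1=\{\tau_1\}$, ${\bf T}_m=\emptyset$ for $m\ge2$; for $k=2,\dots,N$, if some processor $m$ has ${\bf T}_m\cup\{\tau_k\}$ passing the test, choose one such $m$ by the fitting strategy (any rule) and add $\tau_k$ to ${\bf T}_m$, else return failure. *)

theory Defs
  imports Complex_Main
begin

record sporadic_task =
  wcet :: real
  period :: real
  deadline :: real

definition valid_task :: "sporadic_task \<Rightarrow> bool" where
  "valid_task x \<longleftrightarrow> wcet x > 0 \<and> period x > 0 \<and> deadline x > 0"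

definition constrained_deadline :: "sporadic_task \<Rightarrow> bool" where
  "constrained_deadline x \<longleftrightarrow> deadline x \<le> period x"

definition utilization :: "sporadic_task \<Rightarrow> real" where
  "utilization x = wcet x / period x"

text \<open>Tasks are indexed by positive natural numbers, and a set of tasks is represented by the set
  of their indices, so that distinct tasks may have equal parameters.\<close>

definition tda_test :: "(nat \<Rightarrow> sporadic_task) \<Rightarrow> nat \<Rightarrow> nat set \<Rightarrow> bool" where
  "tda_test \<tau> k S \<longleftrightarrow>
     (\<exists>t::real. 0 < t \<and> t \<le> deadline (\<tau> k) \<and>
        wcet (\<tau> k) + (\<Sum>i\<in>S. of_int \<lceil>t / period (\<tau> i)\<rceil> * wcet (\<tau> i)) \<le> t)"

text \<open>An assignment maps each processor \<open>m \<in> {1..M}\<close> to the set of tasks it holds.\<close>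

type_synonym assignment = "nat \<Rightarrow> nat set"

definition passing_processors ::
    "nat \<Rightarrow> (nat \<Rightarrow> sporadic_task) \<Rightarrow> nat \<Rightarrow> assignment \<Rightarrow> nat set" where
  "passing_processors M \<tau> k P = {m \<in> {1..M}. tda_test \<tau> k (P m)}"

text \<open>A fitting strategy picks one of the processors in a nonempty candidate set, given the index of
  the task under consideration and the current assignment. The assignment determines the whole
  history of the run, because tasks are considered in index order.\<close>

type_synonym strategy = "nat \<Rightarrow> assignment \<Rightarrow> nat set \<Rightarrow> nat"

definition fitting_strategy :: "nat \<Rightarrow> strategy \<Rightarrow> bool" where
  "fitting_strategy M fit \<longleftrightarrow> (\<forall>k P S. S \<noteq> {} \<and> S \<subseteq> {1..M} \<longrightarrow> fit k P S \<in> S)"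

text \<open>\<open>dm_partition M \<tau> fit k\<close> is the assignment after tasks \<open>1, \<dots>, k\<close> have been considered, or
  \<open>None\<close> if the algorithm has returned failure by then. The first task is placed on processor 1
  without being tested.\<close>

fun dm_partition ::
    "nat \<Rightarrow> (nat \<Rightarrow> sporadic_task) \<Rightarrow> strategy \<Rightarrow> nat \<Rightarrow> assignment option" where
  "dm_partition M \<tau> fit 0 = Some (\<lambda>m. {})"
| "dm_partition M \<tau> fit (Suc 0) = Some (\<lambda>m. if m = 1 then {1} else {})"
| "dm_partition M \<tau> fit (Suc (Suc n)) =
     (case dm_partition M \<tau> fit (Suc n) of
        None \<Rightarrow> None
      | Some P \<Rightarrow>
          (let k = Suc (Suc n); S = passing_processors M \<tau> k P in
           if S = {} then None
           else (let m = fit k P S in Some (P(m := insert k (P m))))))"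

definition short_period_tasks :: "(nat \<Rightarrow> sporadic_task) \<Rightarrow> nat \<Rightarrow> nat set" where
  "short_period_tasks \<tau> k = {i. 1 \<le> i \<and> i < k \<and> period (\<tau> i) < deadline (\<tau> k)}"

definition long_period_tasks :: "(nat \<Rightarrow> sporadic_task) \<Rightarrow> nat \<Rightarrow> nat set" where
  "long_period_tasks \<tau> k = {i. 1 \<le> i \<and> i < k \<and> period (\<tau> i) \<ge> deadline (\<tau> k)}"

definition inflated_wcet :: "nat \<Rightarrow> (nat \<Rightarrow> sporadic_task) \<Rightarrow> nat \<Rightarrow> real" where
  "inflated_wcet M \<tau> k =
     wcet (\<tau> k) + (1 / real M) * (\<Sum>i\<in>long_period_tasks \<tau> k. wcet (\<tau> i))"

end

theory Submission
  imports Defs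
begin

text \<open>If the test fails on every processor, averaging the failed inequalities over the processors
  gives one failing processor with demands scaled by \<open>1/M\<close>, on which every task of period at least
  \<open>D\<^sub>k\<close> contributes exactly one job. For the remaining tasks let \<open>t\<^sub>i\<close> be the last multiple of \<open>T\<^sub>i\<close>
  strictly before \<open>D\<^sub>k\<close>. With \<open>u\<^sub>i = U\<^sub>i/M\<close> and \<open>X = \<Sum> t\<^sub>i u\<^sub>i\<close>, failure at the points \<open>t\<^sub>j\<close> bounds
  \<open>t\<^sub>j\<close> by \<open>C' + X + \<Sum> {t\<^sub>i u\<^sub>i | t\<^sub>i < t\<^sub>j}\<close>; these partial sums then grow at most by the factor
  \<open>1 + u\<^sub>j\<close> per task, so \<open>C' + 2X \<le> (C' + X) \<Prod> (1 + u\<^sub>i)\<close>. Failure at \<open>D\<^sub>k\<close> gives \<open>C' + 2X > D\<^sub>k\<close>,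
  and together these force the product above \<open>2 / (1 + C'/D\<^sub>k)\<close>.\<close>

lemma sum_le_prod_if_le_partial_sums:
  fixes t u :: "'a \<Rightarrow> real"
  assumes "finite A" and "\<And>i. i \<in> A \<Longrightarrow> 0 \<le> t i" and "\<And>i. i \<in> A \<Longrightarrow> 0 \<le> u i"
    and "\<And>j. j \<in> A \<Longrightarrow> t j \<le> Y + (\<Sum>i | i \<in> A \<and> t i < t j. t i * u i)"
  shows "Y + (\<Sum>i\<in>A. t i * u i) \<le> Y * (\<Prod>i\<in>A. 1 + u i)"
  using assms
\<comment> \<open>Elements are added in order of non-decreasing \<open>t\<close>, so the new
  \<open>x\<close> has the largest value so far. The rule does not supply
  \<open>x \<notin> S\<close>, hence the case split.\<close>
proof (induction A rule: finite_ranking_induct[where f = t])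
  case empty
  then show ?case by simp
next
  case (insert x S)
  show ?case
  proof (cases "x \<in> S")
    case True
    then show ?thesis using insert by (simp add: insert_absorb)
  next
    case False
    have IH: "Y + (\<Sum>i\<in>S. t i * u i) \<le> Y * (\<Prod>i\<in>S. 1 + u i)"
    proof (rule insert.IH)
      fix j assume j: "j \<in> S"
      \<comment> \<open>Since \<open>t j \<le> t x\<close>, the strict comparison excludes
        \<open>x\<close>, so the bound for \<open>j\<close> involves \<open>S\<close> alone.\<close>
      then have "{i. i \<in> insert x S \<and> t i < t j} = {i. i \<in> S \<and> t i < t j}"
        using insert.hyps(2) by fastforce
      then show "t j \<le> Y + (\<Sum>i | i \<in> S \<and> t i < t j. t i * u i)"
        using insert.prems(3)[of j] j by simp
    qed (use insert.prems in auto)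
    have "{i. i \<in> insert x S \<and> t i < t x} \<subseteq> S" by auto
    then have "(\<Sum>i | i \<in> insert x S \<and> t i < t x. t i * u i) \<le> (\<Sum>i\<in>S. t i * u i)"
      using insert.hyps(1) insert.prems(1,2) by (intro sum_mono2) auto
    then have tx: "t x \<le> Y + (\<Sum>i\<in>S. t i * u i)"
      using insert.prems(3)[of x] by simp
    have ux: "0 \<le> u x" using insert.prems(2) by simp
    have "Y + (\<Sum>i\<in>insert x S. t i * u i) = (Y + (\<Sum>i\<in>S. t i * u i)) + t x * u x"
      using insert.hyps(1) False by simp
    also have "\<dots> \<le> (Y + (\<Sum>i\<in>S. t i * u i)) * (1 + u x)"
      using mult_right_mono[OF tx ux] by (simp add: algebra_simps)
    also have "\<dots> \<le> Y * (\<Prod>i\<in>S. 1 + u i) * (1 + u x)"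
      using IH ux by (intro mult_right_mono) auto
    also have "\<dots> = Y * (\<Prod>i\<in>insert x S. 1 + u i)"
      using insert.hyps(1) False by simp
    finally show ?thesis .
  qed
qed

text \<open>This is the time-demand test on one virtual processor, where a task has period
  \<open>T i\<close> and execution time \<open>T i * u i\<close>. Instantiating \<open>u i\<close>
  with utilization over \<open>M\<close> yields the average of the real processors.\<close>

lemma hyperbolic_time_demand_bound:
  fixes T u :: "'a \<Rightarrow> real"
  assumes fin: "finite A" and C: "0 < C" and D: "0 < D"
    and T: "\<And>i. i \<in> A \<Longrightarrow> 0 < T i" "\<And>i. i \<in> A \<Longrightarrow> T i < D"
    and u: "\<And>i. i \<in> A \<Longrightarrow> 0 \<le> u i"
    and prod: "(\<Prod>i\<in>A. 1 + u i) \<le> 2 / (1 + C / D)"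
  shows "\<exists>t. 0 < t \<and> t \<le> D \<and> C + (\<Sum>i\<in>A. of_int \<lceil>t / T i\<rceil> * (T i * u i)) \<le> t"
proof (rule ccontr)
  assume "\<not> ?thesis"
  then have fail: "s < C + (\<Sum>i\<in>A. of_int \<lceil>s / T i\<rceil> * (T i * u i))" if "0 < s" "s \<le> D" for s
    using that by (meson not_le)
  \<comment> \<open>Ceiling minus one rather than floor: if \<open>T i\<close> divides
    \<open>D\<close>, this gives \<open>D - T i\<close>, so \<open>t i < D\<close> always
    holds.\<close>
  define t where "t i = (of_int \<lceil>D / T i\<rceil> - 1) * T i" for i
  define X where "X = (\<Sum>i\<in>A. t i * u i)"
  have t_props: "T i \<le> t i" "t i < D" if i: "i \<in> A" for i
  proof -
    have "1 < D / T i" using T i by simp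
    then have "2 \<le> \<lceil>D / T i\<rceil>" by linarith
    then have "1 \<le> real_of_int \<lceil>D / T i\<rceil> - 1" by linarith
    then show "T i \<le> t i" using T(1)[OF i] by (simp add: t_def)
    have "real_of_int \<lceil>D / T i\<rceil> - 1 < D / T i" by linarith
    then show "t i < D" using T(1)[OF i] by (simp add: t_def pos_less_divide_eq)
  qed
  have t0: "0 < t i" if "i \<in> A" for i
    using t_props(1)[OF that] T(1)[OF that] by linarith
  \<comment> \<open>Up to and including \<open>t i\<close> the jobs cost at most
    \<open>t i * u i\<close>. After it, up to \<open>D\<close>, there is at most one more job, of
    cost \<open>T i * u i \<le> t i * u i\<close>.\<close>
  have demand: "of_int \<lceil>s / T i\<rceil> * (T i * u i) \<le> t i * u i + (if t i < s then t i * u i else 0)"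
    if i: "i \<in> A" and s: "s \<le> D" for i s
  proof (cases "t i < s")
    case True
    have "s / T i \<le> D / T i" using s T(1)[OF i] by (simp add: divide_right_mono)
    then have "\<lceil>s / T i\<rceil> \<le> \<lceil>D / T i\<rceil>" by (rule ceiling_mono)
    then have "of_int \<lceil>s / T i\<rceil> * T i \<le> of_int \<lceil>D / T i\<rceil> * T i"
      using T(1)[OF i] by simp
    also have "\<dots> = t i + T i" by (simp add: t_def algebra_simps)
    also have "\<dots> \<le> t i + t i" using t_props(1)[OF i] by simp
    finally have "of_int \<lceil>s / T i\<rceil> * T i * u i \<le> (t i + t i) * u i"
      using u[OF i] by (rule mult_right_mono)
    then show ?thesis using True by (simp add: algebra_simps)
  next
    case False
    then have "s / T i \<le> of_int (\<lceil>D / T i\<rceil> - 1)"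
      using T(1)[OF i] by (simp add: t_def pos_divide_le_eq)
    then have "\<lceil>s / T i\<rceil> \<le> \<lceil>D / T i\<rceil> - 1" by (rule ceiling_le)
    then have "real_of_int \<lceil>s / T i\<rceil> \<le> of_int \<lceil>D / T i\<rceil> - 1" by linarith
    then have "of_int \<lceil>s / T i\<rceil> * T i \<le> t i"
      using T(1)[OF i] by (simp add: t_def)
    then have "of_int \<lceil>s / T i\<rceil> * T i * u i \<le> t i * u i"
      using u[OF i] by (rule mult_right_mono)
    then show ?thesis using False by (simp add: algebra_simps)
  qed
  have step: "s < C + X + (\<Sum>i | i \<in> A \<and> t i < s. t i * u i)" if "0 < s" "s \<le> D" for s
  proof -
    have "s < C + (\<Sum>i\<in>A. of_int \<lceil>s / T i\<rceil> * (T i * u i))" using fail that .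
    also have "\<dots> \<le> C + (\<Sum>i\<in>A. t i * u i + (if t i < s then t i * u i else 0))"
      using demand that by (intro add_left_mono sum_mono)
    also have "\<dots> = C + X + (\<Sum>i | i \<in> A \<and> t i < s. t i * u i)"
      using fin by (simp add: sum.distrib X_def sum.inter_filter)
    finally show ?thesis .
  qed
  have X0: "0 \<le> X" unfolding X_def using t0 u by (intro sum_nonneg mult_nonneg_nonneg) (auto intro: less_imp_le)
  have "(C + X) + X \<le> (C + X) * (\<Prod>i\<in>A. 1 + u i)"
    unfolding X_def
  proof (rule sum_le_prod_if_le_partial_sums[OF fin])
    fix j assume j: "j \<in> A"
    show "t j \<le> C + (\<Sum>i\<in>A. t i * u i) + (\<Sum>i | i \<in> A \<and> t i < t j. t i * u i)"
      using step[OF t0[OF j]] t_props(2)[OF j] by (simp add: X_def)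
  qed (use t0 u in \<open>auto intro: less_imp_le\<close>)
  also have "\<dots> \<le> (C + X) * (2 / (1 + C / D))"
    using prod C X0 by (intro mult_left_mono) auto
  also have "\<dots> = (C + X) * (2 * D) / (D + C)"
    using C D by (simp add: field_simps)
  finally have "(C + X + X) * (D + C) \<le> (C + X) * (2 * D)"
    using C D by (simp add: pos_le_divide_eq)
  then have "C * (C + 2 * X) \<le> C * D" by (simp add: algebra_simps)
  then have "C + 2 * X \<le> D" using C by simp
  \<comment> \<open>At \<open>s = D\<close> every task has passed its \<open>t i\<close>, so the
    partial sum in \<open>step\<close> is all of \<open>X\<close>.\<close>
  moreover have "{i. i \<in> A \<and> t i < D} = A" using t_props(2) by auto
  then have "D < C + X + X" using step[of D] D by (simp add: X_def)
  ultimately show False by simp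
qed

text \<open>Each step puts a fresh index on exactly one processor in \<open>{1..M}\<close>, so no
  task is lost or counted twice.\<close>

lemma dm_partition_sum:
  fixes f :: "nat \<Rightarrow> real"
  assumes M: "M \<ge> 1" and fit: "fitting_strategy M fit"
    and "dm_partition M \<tau> fit n = Some P"
  shows "(\<Sum>m\<in>{1..M}. sum f (P m)) = sum f {1..n}"
proof -
  \<comment> \<open>The inclusion is carried along to show that \<open>Suc n\<close> is new to the
    chosen processor.\<close>
  have "(\<forall>m. P m \<subseteq> {1..n}) \<and> (\<Sum>m\<in>{1..M}. sum f (P m)) = sum f {1..n}"
    using assms(3)
  proof (induction n arbitrary: P)
    case 0
    then show ?case by auto
  next
    case (Suc n)
    show ?case
    proof (cases n)
      case 0
      have "(\<Sum>m\<in>{1..M}. sum f (if m = 1 then {1} else {})) = (\<Sum>m\<in>{1..M}. if m = 1 then f 1 else 0)"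
        by (rule sum.cong) auto
      then show ?thesis using Suc.prems 0 M by (auto split: if_splits)
    next
      case (Suc n')
      obtain Q where Q: "dm_partition M \<tau> fit n = Some Q"
        using Suc.prems Suc by (auto split: option.splits)
      define S where "S = passing_processors M \<tau> (Suc n) Q"
      define p where "p = fit (Suc n) Q S"
      have S: "S \<noteq> {}" and P: "P = Q(p := insert (Suc n) (Q p))"
        using Suc.prems Suc Q by (auto simp: S_def p_def Let_def split: if_splits)
      have "S \<subseteq> {1..M}" by (auto simp: S_def passing_processors_def)
      with S fit have p: "p \<in> {1..M}"
        unfolding fitting_strategy_def p_def by blast
      have sub: "Q m \<subseteq> {1..n}" for m using Suc.IH[OF Q] by blast
      have "finite (Q p)" "Suc n \<notin> Q p"
        using sub[of p] by (auto intro: finite_subset)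
      then have "sum f (P m) = sum f (Q m) + (if m = p then f (Suc n) else 0)" for m
        by (simp add: P)
      then have "(\<Sum>m\<in>{1..M}. sum f (P m)) = (\<Sum>m\<in>{1..M}. sum f (Q m)) + f (Suc n)"
        using p by (simp add: sum.distrib)
      moreover have "P m \<subseteq> {1..Suc n}" for m
        using sub[of m] by (cases "m = p") (auto simp: P subset_iff le_SucI)
      ultimately show ?thesis using Suc.IH[OF Q] by simp
    qed
  qed
  then show ?thesis ..
qed

theorem theorem5:
  fixes M N k :: nat and \<tau> :: "nat \<Rightarrow> sporadic_task" and fit :: strategy and P :: assignment
  assumes "M \<ge> 1"
    and "\<And>i. i \<in> {1..N} \<Longrightarrow> valid_task (\<tau> i)"
    and "\<And>i. i \<in> {1..N} \<Longrightarrow> constrained_deadline (\<tau> i)"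
    and "mono_on {1..N} (\<lambda>i. deadline (\<tau> i))"
    and "fitting_strategy M fit"
    and "2 \<le> k" and "k \<le> N"
    and "dm_partition M \<tau> fit (k - 1) = Some P"
    and "(\<Prod>i\<in>short_period_tasks \<tau> k. 1 + utilization (\<tau> i) / real M)
           \<le> 2 / (1 + inflated_wcet M \<tau> k / deadline (\<tau> k))"
  shows "(\<exists>m\<in>{1..M}. tda_test \<tau> k (P m)) \<and> dm_partition M \<tau> fit k \<noteq> None"
proof -
  let ?A = "short_period_tasks \<tau> k" and ?B = "long_period_tasks \<tau> k"
  let ?D = "deadline (\<tau> k)"
  have valid: "0 < wcet (\<tau> i)" "0 < period (\<tau> i)" "0 < deadline (\<tau> i)" if "1 \<le> i" "i \<le> k" for i
    using assms(2)[of i] assms(7) that by (auto simp: valid_task_def)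
  have AB: "?A \<union> ?B = {1..k - 1}" "?A \<inter> ?B = {}"
    using assms(6) by (auto simp: short_period_tasks_def long_period_tasks_def)
  then have fin: "finite ?A" "finite ?B"
    by (metis finite_Un finite_atLeastAtMost)+
  have M: "0 < real M" using assms(1) by simp
  have D: "0 < ?D" and Ck: "0 < wcet (\<tau> k)" using valid[of k] assms(6) by auto
  have "0 \<le> (\<Sum>i\<in>?B. wcet (\<tau> i))"
    by (intro sum_nonneg) (auto simp: long_period_tasks_def intro: less_imp_le[OF valid(1)])
  then have C: "0 < inflated_wcet M \<tau> k"
    using Ck by (simp add: inflated_wcet_def add_pos_nonneg)
  have "\<exists>t. 0 < t \<and> t \<le> ?D \<and> inflated_wcet M \<tau> k
      + (\<Sum>i\<in>?A. of_int \<lceil>t / period (\<tau> i)\<rceil> * (period (\<tau> i) * (utilization (\<tau> i) / real M))) \<le> t"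
  proof (rule hyperbolic_time_demand_bound[OF fin(1) C D _ _ _ assms(9)])
    fix i assume "i \<in> ?A"
    then show "0 < period (\<tau> i)" "period (\<tau> i) < ?D" "0 \<le> utilization (\<tau> i) / real M"
      using valid[of i] by (auto simp: short_period_tasks_def utilization_def)
  qed
  then obtain t where t: "0 < t" "t \<le> ?D" and demand: "inflated_wcet M \<tau> k
      + (\<Sum>i\<in>?A. of_int \<lceil>t / period (\<tau> i)\<rceil> * (period (\<tau> i) * (utilization (\<tau> i) / real M))) \<le> t"
    by blast
  \<comment> \<open>With \<open>t\<close> fixed, \<open>f i\<close> is the demand of task
    \<open>i\<close> on whichever processor holds it.\<close>
  define f where "f i = of_int \<lceil>t / period (\<tau> i)\<rceil> * wcet (\<tau> i)" for i
  have "of_int \<lceil>t / period (\<tau> i)\<rceil> * (period (\<tau> i) * (utilization (\<tau> i) / real M)) = f i / real M"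
    if "i \<in> ?A" for i
    using that valid(2)[of i] by (simp add: f_def short_period_tasks_def utilization_def)
  then have A: "(\<Sum>i\<in>?A. of_int \<lceil>t / period (\<tau> i)\<rceil> * (period (\<tau> i) * (utilization (\<tau> i) / real M)))
      = sum f ?A / real M"
    unfolding sum_divide_distrib by (rule sum.cong[OF refl])
  \<comment> \<open>Here \<open>0 < t \<le> ?D \<le> period (\<tau> i)\<close>, so exactly one job
    counts.\<close>
  have "f i = wcet (\<tau> i)" if "i \<in> ?B" for i
  proof -
    have "0 < t / period (\<tau> i)" "t / period (\<tau> i) \<le> 1"
      using that t valid(2)[of i] by (auto simp: long_period_tasks_def)
    then have "\<lceil>t / period (\<tau> i)\<rceil> = 1" by linarith
    then show ?thesis by (simp add: f_def)
  qed
  then have B: "(\<Sum>i\<in>?B. wcet (\<tau> i)) = sum f ?B" by simp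
  have "sum f ?A + sum f ?B = sum f {1..k - 1}"
    using sum.union_disjoint[OF fin AB(2), of f] AB(1) by simp
  also have "\<dots> = (\<Sum>m\<in>{1..M}. sum f (P m))"
    using dm_partition_sum[OF assms(1,5,8)] by simp
  finally have total: "real M * wcet (\<tau> k) + (\<Sum>m\<in>{1..M}. sum f (P m)) \<le> real M * t"
    using demand M unfolding A inflated_wcet_def B by (simp add: field_simps)
  \<comment> \<open>Pigeonhole: at this common \<open>t\<close> the average demand over the
    processors is at most \<open>t\<close>, so some processor does not exceed it.\<close>
  have "\<exists>m\<in>{1..M}. wcet (\<tau> k) + sum f (P m) \<le> t"
  proof (rule ccontr)
    assume "\<not> ?thesis"
    then have "(\<Sum>m\<in>{1..M}. t) < (\<Sum>m\<in>{1..M}. wcet (\<tau> k) + sum f (P m))"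
      using assms(1) by (intro sum_strict_mono) (auto simp: not_le)
    then show False using total by (simp add: sum.distrib)
  qed
  then have pass: "\<exists>m\<in>{1..M}. tda_test \<tau> k (P m)"
    using t unfolding tda_test_def f_def by blast
  obtain n where n: "k = Suc (Suc n)"
    using assms(6) by (metis add_2_eq_Suc le_Suc_ex)
  have "passing_processors M \<tau> k P \<noteq> {}"
    using pass by (auto simp: passing_processors_def)
  then have "dm_partition M \<tau> fit k \<noteq> None"
    using assms(8) n by (simp add: Let_def)
  with pass show ?thesis by blast
qed

end
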